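(* Let $(X,A,m,\alpha)$ be a micro-macro system and let $(A,\to)$ be its directed graph of reproducible transitions. Then $(A,\to)$ is a disjoint union of directed cycles (including possibly loops $a\to a$) and rooted trees, with all edges of each tree directed towards its root (a macrostate with no outgoing edge). The entropy $S$ is constant on each cycle, and entropy increases (i.e. $S(a)\le S(b)$ for every edge $a\to b$) along paths towards the roots.
   Context: A micro-macro system $(X,A,m,\alpha)$ consists of finite sets $X$ and $A$, a bijection $\alpha:X\to X$ and a surjection $m:X\to A$; a macrostate $a$ is identified with the subset $m^{-1}(a)\subseteq X$ and $|a|=|m^{-1}(a)|$, $S(a)=\ln|a|$. A transition $a\to b$ between macrostates is reproducible if $\alpha(a)\subseteq b$, i.e. $\alpha(i)\in b$ for all $i\in a$. The graph $(A,\to)$ has vertex set $A$ and an edge $a\to b$ for each reproducible transition. *)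

theory Defs
  imports Complex_Main "Graph_Theory.Digraph_Component"
begin

locale micro_macro_system =
  fixes X :: "'x set" and A :: "'a set" and m :: "'x \<Rightarrow> 'a" and \<alpha> :: "'x \<Rightarrow> 'x"
  assumes finite_micro: "finite X"
    and finite_macro: "finite A"
    and m_surj: "m ` X = A"
    and \<alpha>_bij: "bij_betw \<alpha> X X"

definition macrostate :: "'x set \<Rightarrow> ('x \<Rightarrow> 'a) \<Rightarrow> 'a \<Rightarrow> 'x set" where
  "macrostate X m a = {i \<in> X. m i = a}"

definition entropy :: "'x set \<Rightarrow> ('x \<Rightarrow> 'a) \<Rightarrow> 'a \<Rightarrow> real" where
  "entropy X m a = ln (real (card (macrostate X m a)))"

definition reproducible :: "'x set \<Rightarrow> ('x \<Rightarrow> 'a) \<Rightarrow> ('x \<Rightarrow> 'x) \<Rightarrow> 'a \<Rightarrow> 'a \<Rightarrow> bool" where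
  "reproducible X m \<alpha> a b \<longleftrightarrow> \<alpha> ` macrostate X m a \<subseteq> macrostate X m b"

definition transition_graph ::
    "'x set \<Rightarrow> 'a set \<Rightarrow> ('x \<Rightarrow> 'a) \<Rightarrow> ('x \<Rightarrow> 'x) \<Rightarrow> 'a pair_pre_digraph" where
  "transition_graph X A m \<alpha> =
    \<lparr> pverts = A, parcs = {(a, b). a \<in> A \<and> b \<in> A \<and> reproducible X m \<alpha> a b} \<rparr>"

definition disjoint_union_of :: "'a pair_pre_digraph \<Rightarrow> 'a pair_pre_digraph set \<Rightarrow> bool" where
  "disjoint_union_of G \<H> \<longleftrightarrow>
    pairwise (\<lambda>H K. disjnt (pverts H) (pverts K)) \<H> \<and>
    pverts G = (\<Union>H\<in>\<H>. pverts H) \<and> parcs G = (\<Union>H\<in>\<H>. parcs H)"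

text \<open>A library cycle is a nonempty closed walk without repeated vertices, so it may be a loop
  or have length two.\<close>

definition directed_cycle :: "'a pair_pre_digraph \<Rightarrow> bool" where
  "directed_cycle C \<longleftrightarrow>
    (\<exists>p. pre_digraph.cycle (with_proj C) p \<and> parcs C = set p \<and> pverts C = fst ` set p)"

text \<open>The predicate \<^const>\<open>Digraph_Component.tree\<close> only excludes directed cycles.
  Here the underlying undirected graph is required to be a tree. Asymmetry excludes loops and pairs
  of antiparallel arcs; a cycle of length two in the symmetrization just runs through one
  undirected edge back and forth.\<close>

definition undirected_tree :: "'a pair_pre_digraph \<Rightarrow> bool" where
  "undirected_tree T \<longleftrightarrow>
    pair_wf_digraph T \<and> asym (parcs T) \<and> Digraph_Component.connected (with_proj T) \<and>
    \<not> (\<exists>p. pre_digraph.cycle (with_proj (mk_symmetric (with_proj T))) p \<and> 3 \<le> length p)"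

text \<open>An arc \<open>(u, v)\<close> is directed towards the root \<open>r\<close> if the path from \<open>u\<close> to \<open>r\<close> in the
  underlying undirected tree starts with the step from \<open>u\<close> to \<open>v\<close>.\<close>

definition rooted_tree_towards :: "'a pair_pre_digraph \<Rightarrow> 'a \<Rightarrow> bool" where
  "rooted_tree_towards T r \<longleftrightarrow>
    undirected_tree T \<and> r \<in> pverts T \<and>
    (\<forall>(u, v) \<in> parcs T.
      \<exists>p. pre_digraph.apath (with_proj (mk_symmetric (with_proj T))) u ((u, v) # p) r)"

end

theory Submission
  imports Defs
begin

text \<open>Macrostates are nonempty, so every macrostate has at most one reproducible successor, and
  \<open>\<alpha>\<close> being injective, \<open>a \<rightarrow> b\<close> forces \<open>|a| \<le> |b|\<close>. Along a directed cycle all sizes therefore agree,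
  so \<open>\<alpha>\<close> maps each macrostate of the cycle onto the next one. Hence a further macrostate \<open>c\<close> with an
  edge into the cycle would meet the predecessor on the cycle, which is absurd: nothing flows into a
  cycle from outside. A finite functional graph with this property splits into its cycles and, for
  each vertex without successor, the in-tree of all vertices leading to it.\<close>

section \<open>Cycles as lists of pairs\<close>

lemma pcas_map_snd: "pcas u p v \<Longrightarrow> u # map snd p = map fst p @ [v]"
  by (induction p arbitrary: u) auto

text \<open>Replaces the library cycle by list facts without a base point: in a closed walk the
  heads are the tails shifted by one. The library asks for distinct heads; rotation only permutes
  the list, so the tails are distinct too.\<close>

lemma cycle_rotate1:
  assumes "pre_digraph.cycle (with_proj G) p"
  shows "map snd p = rotate1 (map fst p)" and "distinct (map fst p)"
    and "p \<noteq> []" and "set p \<subseteq> parcs G"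
proof -
  obtain u where walk: "pcas u p u" and dist: "distinct (tl (pawalk_verts u p))"
    and p: "p \<noteq> []" "set p \<subseteq> parcs G"
    using assms
    by (auto simp: pre_digraph.cycle_def pre_digraph.awalk_def
        cas_with_proj_eq awalk_verts_with_proj_eq)
  from p show "p \<noteq> []" "set p \<subseteq> parcs G" by auto
  show rot: "map snd p = rotate1 (map fst p)"
    using pcas_map_snd[OF walk] p(1) by (cases p) auto
  have verts: "pawalk_verts v q = v # map snd q" if "pcas v q w" for v q w
    using that by (induction q arbitrary: v) auto
  have "distinct (map snd p)"
    using dist verts[OF walk] by simp
  then show "distinct (map fst p)"
    unfolding rot by simp
qed

lemma cycle_nth_Suc:
  assumes "pre_digraph.cycle (with_proj G) p" and "i < length p"
  shows "snd (p ! i) = fst (p ! (Suc i mod length p))"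
proof -
  have "snd (p ! i) = rotate1 (map fst p) ! i"
    using cycle_rotate1(1)[OF assms(1)] assms(2) by (metis nth_map)
  also have "\<dots> = fst (p ! (Suc i mod length p))"
    using assms(2) cycle_rotate1(3)[OF assms(1)] by (simp add: nth_rotate1 del: mod_Suc_eq)
  finally show ?thesis .
qed

section \<open>Functional graphs\<close>

text \<open>A functional relation offers no exit from a cycle: the step from \<open>b\<close> to
  \<open>c\<close> must be the first step of a walk from \<open>b\<close> back to itself, so
  \<open>c\<close> still leads back.\<close>

lemma single_valued_cyclic_reachable:
  assumes "single_valued R" and "(a, a) \<in> R\<^sup>+" and "(a, b) \<in> R\<^sup>*"
  shows "(b, a) \<in> R\<^sup>* \<and> (b, b) \<in> R\<^sup>+"
  using assms(3)
proof (induction rule: rtrancl_induct)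
  case base
  show ?case using assms(2) by simp
next
  case (step b c)
  obtain z where "(b, z) \<in> R" "(z, b) \<in> R\<^sup>*"
    using step.IH by (meson tranclD)
  then have "(c, b) \<in> R\<^sup>*"
    using assms(1) step.hyps by (metis single_valuedD)
  then show ?case
    using step by (meson rtrancl_into_trancl1 rtrancl_trans)
qed

text \<open>A simple path back from the successor of \<open>a\<close> closes up to a cycle. As
  successors are unique, no arc leaves this cycle, so it exhausts everything reachable from
  \<open>a\<close>.\<close>

lemma directed_cycleI:
  assumes "pair_wf_digraph C" and sv: "single_valued (parcs C)"
    and cyc: "(a, a) \<in> (parcs C)\<^sup>+"
    and reach: "\<And>v. v \<in> pverts C \<Longrightarrow> (a, v) \<in> (parcs C)\<^sup>*"
  shows "directed_cycle C"
proof -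
  interpret C: pair_wf_digraph C by fact
  obtain b where b: "(a, b) \<in> parcs C" "(b, a) \<in> (parcs C)\<^sup>*"
    using cyc by (meson tranclD)
  have "a \<in> pverts C" "b \<in> pverts C" using b(1) by (rule C.in_arcsD1, rule C.in_arcsD2)
  then have "b \<rightarrow>\<^sup>*\<^bsub>C\<^esub> a"
    using b(2) by (simp add: C.reachable_conv)
  then obtain p where p: "C.apath b p a"
    by (auto simp: C.reachable_apath)
  \<comment> \<open>If \<open>a = b\<close>, the simple path \<open>p\<close> is empty and
    \<open>q\<close> is a loop.\<close>
  define q where "q = (a, b) # p"
  have cyc: "C.cycle q"
    using p b(1) unfolding C.cycle_def C.apath_def q_def
    by (intro exI[of _ a]) (auto simp: C.awalk_Cons_iff)
  note rot = cycle_rotate1[OF cyc]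
  have snd_fst: "snd ` set q = fst ` set q"
    using arg_cong[OF rot(1), of set] by (simp only: set_map set_rotate1)
  have closed: "(v, w) \<in> set q" if "v \<in> fst ` set q" "(v, w) \<in> parcs C" for v w
  proof -
    obtain w' where w': "(v, w') \<in> set q" using \<open>v \<in> fst ` set q\<close> by fastforce
    then have "w' = w" using rot(4) sv that(2) by (meson single_valuedD subsetD)
    then show ?thesis using w' by simp
  qed
  have on_cycle: "v \<in> fst ` set q" if "(a, v) \<in> (parcs C)\<^sup>*" for v
    using that
  proof (induction rule: rtrancl_induct)
    case base
    show ?case by (simp add: q_def)
  next
    case (step v w)
    then have "w \<in> snd ` set q" using closed by force
    then show ?case using snd_fst by simp
  qed
  have verts: "pverts C = fst ` set q"
  proof
    show "pverts C \<subseteq> fst ` set q" using reach on_cycle by blast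
    show "fst ` set q \<subseteq> pverts C" using C.in_arcsD1 rot(4) by auto
  qed
  moreover have "parcs C = set q"
  proof
    show "parcs C \<subseteq> set q"
      using closed verts C.in_arcsD1 by (intro subrelI) simp
  qed (rule rot(4))
  ultimately show ?thesis
    using cyc unfolding directed_cycle_def by blast
qed

text \<open>On a long undirected cycle, a vertex without predecessor on the cycle would have its two
  distinct neighbours both as successors.\<close>

lemma acyclic_functional_no_undirected_cycle:
  assumes "finite (parcs T)" and "single_valued (parcs T)" and "acyclic (parcs T)"
    and cyc: "pre_digraph.cycle (with_proj (mk_symmetric (with_proj T))) p"
  shows "length p < 3"
proof (rule ccontr)
  assume "\<not> length p < 3"
  then have len: "3 \<le> length p" by simp
  note rot = cycle_rotate1[OF cyc] and next_arc = cycle_nth_Suc[OF cyc]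
  have arc: "e \<in> parcs T \<or> (snd e, fst e) \<in> parcs T" if "e \<in> set p" for e
    using rot(4) that by (fastforce simp: parcs_mk_symmetric)
  \<comment> \<open>A vertex of the cycle that is minimal for the well-founded arc relation has no
    predecessor on the cycle.\<close>
  have "wf (parcs T)"
    using assms by (simp add: finite_acyclic_wf)
  moreover have "fst (hd p) \<in> fst ` set p" using rot(3) by simp
  ultimately obtain v where v: "v \<in> fst ` set p"
      and min: "\<And>w. (w, v) \<in> parcs T \<Longrightarrow> w \<notin> fst ` set p"
    by (metis wfE_min)
  have "snd ` set p = fst ` set p"
    using arg_cong[OF rot(1), of set] by (simp only: set_map set_rotate1)
  then obtain i where i: "i < length p" "snd (p ! i) = v"
    using v by (metis (no_types, lifting) imageE in_set_conv_nth)
  \<comment> \<open>Arc \<open>i\<close> of the cycle enters \<open>v\<close>, arc \<open>?j\<close>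
    leaves it, and arc \<open>?k\<close> starts at the vertex after \<open>v\<close>; the neighbours
    of \<open>v\<close> are thus the tails of arcs \<open>i\<close> and \<open>?k\<close>.\<close>
  let ?j = "Suc i mod length p" and ?k = "Suc (Suc i) mod length p"
  have j: "?j < length p" and k: "?k < length p" using rot(3) by simp_all
  have fst_j: "fst (p ! ?j) = v" using next_arc[OF i(1)] i(2) by simp
  have snd_j: "snd (p ! ?j) = fst (p ! ?k)" using next_arc[OF j] by (simp add: mod_Suc_eq)
  have mem: "p ! i \<in> set p" "p ! ?j \<in> set p" "p ! ?k \<in> set p" using i j k by auto
  have "(v, fst (p ! i)) \<in> parcs T"
    using arc[OF mem(1)] min[of "fst (p ! i)"] mem(1) i(2) by (metis imageI prod.collapse)
  moreover have "(v, fst (p ! ?k)) \<in> parcs T"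
    using arc[OF mem(2)] min[of "fst (p ! ?k)"] mem(3) fst_j snd_j by (metis imageI prod.collapse)
  ultimately have "fst (p ! i) = fst (p ! ?k)"
    using assms(2) by (meson single_valuedD)
  \<comment> \<open>Tails are distinct, so equal tails mean equal indices; but a shift by two modulo
    the length fixes no index once the length is at least 3.\<close>
  then have "i = ?k"
    using rot(2) i(1) k by (metis length_map nth_eq_iff_index_eq nth_map)
  then show False
    using len i(1) by (cases "Suc (Suc i) < length p") (auto simp: le_mod_geq)
qed

text \<open>Any two vertices are joined through \<open>r\<close> in the symmetrization. For an arc
  \<open>(u, v)\<close>, a directed path from \<open>v\<close> to \<open>r\<close> serves as the
  undirected one; it avoids \<open>u\<close>, since otherwise a directed cycle would arise.\<close>

lemma rooted_tree_towardsI: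
  assumes "pair_fin_digraph T" and sv: "single_valued (parcs T)" and acyc: "acyclic (parcs T)"
    and root: "r \<in> pverts T" and reach: "\<And>v. v \<in> pverts T \<Longrightarrow> (v, r) \<in> (parcs T)\<^sup>*"
  shows "rooted_tree_towards T r"
proof -
  interpret T: pair_fin_digraph T by fact
  let ?S = "mk_symmetric (with_proj T)"
  interpret S: pair_wf_digraph ?S by (rule T.wellformed_mk_symmetric)
  have sym_arcs: "parcs T \<subseteq> parcs ?S" by (force simp: parcs_mk_symmetric)
  have to_root: "v \<rightarrow>\<^sup>*\<^bsub>T\<^esub> r" if "v \<in> pverts T" for v
    using reach[OF that] that root by (simp add: T.reachable_conv)
  have "asym (parcs T)"
    using acyc by (intro asymI) (meson acyclic_def r_into_trancl trancl_trans)
  moreover have "Digraph_Component.connected (with_proj T)"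
    unfolding connected_def strongly_connected_def
  proof (intro conjI ballI)
    show "verts (with_proj ?S) \<noteq> {}" using root by auto
  next
    fix u v assume "u \<in> verts (with_proj ?S)" "v \<in> verts (with_proj ?S)"
    then have "u \<rightarrow>\<^sup>*\<^bsub>?S\<^esub> r" "v \<rightarrow>\<^sup>*\<^bsub>?S\<^esub> r"
      using to_root T.reachable_mk_symmetricI by auto
    then show "u \<rightarrow>\<^sup>*\<^bsub>?S\<^esub> v"
      using symmetric_reachable[OF symmetric_mk_symmetric] S.reachable_trans by metis
  qed
  moreover have "\<exists>p. S.apath u ((u, v) # p) r" if uv: "(u, v) \<in> parcs T" for u v
  proof -
    have v: "v \<in> pverts T" using uv by (rule T.in_arcsD2)
    obtain p where p: "T.apath v p r"
      using to_root[OF v] by (auto simp: T.reachable_apath)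
    have "u \<notin> set (pawalk_verts v p)"
    proof
      assume "u \<in> set (pawalk_verts v p)"
      then have "v \<rightarrow>\<^sup>*\<^bsub>T\<^esub> u"
        using p T.awalk_verts_reachable_from T.awalkI_apath by blast
      then have "(v, u) \<in> (parcs T)\<^sup>*" by (simp add: T.reachable_conv)
      then show False using uv acyc by (meson acyclic_def rtrancl_into_trancl2)
    qed
    moreover have "S.apath v p r"
      using p sym_arcs v by (auto simp: S.apath_def T.apath_def S.awalk_def T.awalk_def)
    ultimately show ?thesis
      using uv sym_arcs by (auto simp: S.apath_Cons_iff)
  qed
  ultimately show ?thesis
    using acyclic_functional_no_undirected_cycle[OF T.pair_finite_arcs sv acyc] root
      T.pair_wf_digraph_axioms
    unfolding rooted_tree_towards_def undirected_tree_def by fastforce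
qed

section \<open>Splitting a finite functional graph into cycles and in-trees\<close>

definition cycle_component :: "'a rel \<Rightarrow> 'a \<Rightarrow> 'a pair_pre_digraph" where
  "cycle_component R a = \<lparr> pverts = R\<^sup>* `` {a}, parcs = R \<inter> R\<^sup>* `` {a} \<times> UNIV \<rparr>"

text \<open>Only the heads of arcs are restricted; a tail then leads to \<open>r\<close> as
  well.\<close>

definition in_tree :: "'a rel \<Rightarrow> 'a \<Rightarrow> 'a pair_pre_digraph" where
  "in_tree R r = \<lparr> pverts = {v. (v, r) \<in> R\<^sup>*}, parcs = {(u, v) \<in> R. (v, r) \<in> R\<^sup>*} \<rparr>"

text \<open>Walks from \<open>a\<close> use only arcs whose tails are reachable from
  \<open>a\<close>, so passing to the component loses none of them, in particular not the closed
  walk through \<open>a\<close>.\<close>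

lemma directed_cycle_cycle_component:
  assumes "single_valued R" and "(a, a) \<in> R\<^sup>+"
  shows "directed_cycle (cycle_component R a)"
proof -
  let ?C = "cycle_component R a"
  have reach: "(a, v) \<in> (parcs ?C)\<^sup>*" if "(a, v) \<in> R\<^sup>*" for v
    using that
  proof (induction rule: rtrancl_induct)
    case (step v w)
    then have "(v, w) \<in> parcs ?C" by (simp add: cycle_component_def)
    then show ?case using step.IH by simp
  qed simp
  show ?thesis
  proof (rule directed_cycleI)
    show "pair_wf_digraph ?C"
      by unfold_locales (auto simp: cycle_component_def intro: rtrancl_into_rtrancl)
    show "single_valued (parcs ?C)"
      using assms(1) by (auto simp: cycle_component_def single_valued_def)
    obtain b where b: "(a, b) \<in> R\<^sup>*" "(b, a) \<in> R"
      using assms(2) by (meson tranclD2)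
    then have "(b, a) \<in> parcs ?C" by (simp add: cycle_component_def)
    then show "(a, a) \<in> (parcs ?C)\<^sup>+"
      using reach[OF b(1)] by (rule rtrancl_into_trancl1[rotated])
    show "(a, v) \<in> (parcs ?C)\<^sup>*" if "v \<in> pverts ?C" for v
      using that reach by (simp add: cycle_component_def)
  qed
qed

text \<open>Whatever is reachable from a cyclic vertex is cyclic and hence has a successor.\<close>

lemma sink_not_reachable_from_cycle:
  assumes "single_valued R" and "(a, a) \<in> R\<^sup>+" and "r \<notin> Domain R"
  shows "(a, r) \<notin> R\<^sup>*"
  using single_valued_cyclic_reachable[OF assms(1,2), of r] assms(3)
  by (meson DomainI tranclD)

lemma rooted_tree_in_tree:
  assumes "finite R" and "single_valued R" and "r \<notin> Domain R"
  shows "rooted_tree_towards (in_tree R r) r"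
proof -
  let ?T = "in_tree R r"
  have sub: "parcs ?T \<subseteq> R" by (auto simp: in_tree_def)
  \<comment> \<open>A vertex leading to \<open>r\<close> is \<open>r\<close> or has an outgoing arc,
    so finiteness of \<open>R\<close> bounds the vertex set.\<close>
  have "{v. (v, r) \<in> R\<^sup>*} \<subseteq> insert r (Domain R)"
    by (auto elim: converse_rtranclE)
  then have fin: "finite {v. (v, r) \<in> R\<^sup>*}"
    using assms(1) by (meson finite_Domain finite_insert finite_subset)
  show ?thesis
  proof (rule rooted_tree_towardsI)
    show "pair_fin_digraph ?T"
      using fin finite_subset[OF sub assms(1)]
      by unfold_locales (auto simp: in_tree_def intro: converse_rtrancl_into_rtrancl)
    show "single_valued (parcs ?T)"
      using assms(2) sub by (rule single_valued_subset[rotated])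
    \<comment> \<open>A cycle inside the tree would lead to the sink \<open>r\<close>.\<close>
    show "acyclic (parcs ?T)"
    proof (rule acyclicI, intro allI notI)
      fix v assume cyc: "(v, v) \<in> (parcs ?T)\<^sup>+"
      then obtain w where "(v, w) \<in> parcs ?T" by (meson tranclD)
      then have "(v, r) \<in> R\<^sup>*"
        by (auto simp: in_tree_def intro: converse_rtrancl_into_rtrancl)
      moreover have "(v, v) \<in> R\<^sup>+" using cyc sub trancl_mono by blast
      ultimately show False
        using sink_not_reachable_from_cycle[OF assms(2) _ assms(3)] by blast
    qed
    show "r \<in> pverts ?T" by (simp add: in_tree_def)
    fix v assume "v \<in> pverts ?T"
    then have "(v, r) \<in> R\<^sup>*" by (simp add: in_tree_def)
    then show "(v, r) \<in> (parcs ?T)\<^sup>*"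
    proof (induction rule: converse_rtrancl_induct)
      case (step u w)
      then have "(u, w) \<in> parcs ?T" by (simp add: in_tree_def)
      then show ?case using step.IH by (rule converse_rtrancl_into_rtrancl)
    qed simp
  qed
qed

text \<open>Among the arcs that start at points reachable from \<open>a\<close> there is a cycle, or
  else finiteness makes their converse well-founded; a reachable point minimal for the converse is a
  sink.\<close>

lemma reaches_sink_or_cycle:
  assumes "finite R"
  obtains r where "(a, r) \<in> R\<^sup>*" and "r \<notin> Domain R"
  | c where "(a, c) \<in> R\<^sup>*" and "(c, c) \<in> R\<^sup>+"
proof (cases "acyclic (R \<inter> R\<^sup>* `` {a} \<times> UNIV)")
  case True
  let ?R = "R \<inter> R\<^sup>* `` {a} \<times> UNIV"
  have "wf (?R\<inverse>)"
    using True assms by (simp add: finite_acyclic_wf_converse)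
  moreover have "a \<in> R\<^sup>* `` {a}" by simp
  ultimately obtain r where r: "r \<in> R\<^sup>* `` {a}" "\<And>w. (w, r) \<in> ?R\<inverse> \<Longrightarrow> w \<notin> R\<^sup>* `` {a}"
    by (metis wfE_min)
  then have "r \<notin> Domain R" by (auto intro: rtrancl_into_rtrancl)
  then show thesis using r(1) that(1) by simp
next
  case False
  then obtain c where c: "(c, c) \<in> (R \<inter> R\<^sup>* `` {a} \<times> UNIV)\<^sup>+"
    by (auto simp: acyclic_def)
  then have "(a, c) \<in> R\<^sup>*" by (auto dest: tranclD)
  moreover have "(c, c) \<in> R\<^sup>+" using c trancl_mono by blast
  ultimately show thesis by (rule that(2))
qed

text \<open>In a general finite functional graph, trees may hang on the cycles. The hypothesis
  \<open>pred\<close> forbids this: a vertex leading into a cycle is itself cyclic, so every vertex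
  is cyclic or leads to a sink.\<close>

lemma disjoint_union_of_cycles_and_in_trees:
  assumes "pair_fin_digraph G" and "single_valued (parcs G)"
    and pred: "\<And>a b c. (b, b) \<in> (parcs G)\<^sup>+ \<Longrightarrow> (b, a) \<in> parcs G \<Longrightarrow> (c, a) \<in> parcs G \<Longrightarrow> b = c"
  shows "disjoint_union_of G (cycle_component (parcs G) ` {a. (a, a) \<in> (parcs G)\<^sup>+} \<union>
    in_tree (parcs G) ` {r \<in> pverts G. r \<notin> Domain (parcs G)})"
proof -
  interpret G: pair_fin_digraph G by fact
  define R where "R = parcs G"
  note sv = assms(2)[folded R_def] and pred = pred[folded R_def]
  note cyclic = single_valued_cyclic_reachable[OF sv]
    and sink = sink_not_reachable_from_cycle[OF sv]
  have fin: "finite R" unfolding R_def by (rule G.pair_finite_arcs)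
  let ?\<C> = "cycle_component R ` {a. (a, a) \<in> R\<^sup>+}"
  \<comment> \<open>Requiring \<open>r \<in> pverts G\<close> keeps out the points of the type
    outside \<open>G\<close>, each of which would give a one-vertex tree.\<close>
  let ?\<T> = "in_tree R ` {r \<in> pverts G. r \<notin> Domain R}"
  \<comment> \<open>\<open>CC\<close>, \<open>CT\<close> and \<open>TT\<close> treat two components
    sharing a vertex \<open>v\<close>: two cycles coincide, a cycle and a tree cannot meet, and two
    trees have the same root by confluence.\<close>
  have CC: "cycle_component R a = cycle_component R b"
    if "(a, a) \<in> R\<^sup>+" "(b, b) \<in> R\<^sup>+" "(a, v) \<in> R\<^sup>*" "(b, v) \<in> R\<^sup>*" for a b v
  proof -
    have "(a, b) \<in> R\<^sup>*" "(b, a) \<in> R\<^sup>*"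
      using that cyclic by (meson rtrancl_trans)+
    then have "R\<^sup>* `` {a} = R\<^sup>* `` {b}" by (auto intro: rtrancl_trans)
    then show ?thesis by (simp add: cycle_component_def)
  qed
  have CT: False if "(a, a) \<in> R\<^sup>+" "(a, v) \<in> R\<^sup>*" "(v, r) \<in> R\<^sup>*" "r \<notin> Domain R" for a v r
    using that sink by (meson rtrancl_trans)
  have TT: "r = s" if "(v, r) \<in> R\<^sup>*" "(v, s) \<in> R\<^sup>*" "r \<notin> Domain R" "s \<notin> Domain R" for v r s
    using single_valued_confluent[OF sv that(1,2)] that(3,4)
    by (auto elim: converse_rtranclE)
  have closed: "v \<in> pverts G" if "(u, v) \<in> R\<^sup>*" "u \<in> pverts G" for u v
    using that by (induction rule: rtrancl_induct) (auto simp: R_def dest: G.in_arcsD2)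
  have closed': "u \<in> pverts G" if "(u, v) \<in> R\<^sup>*" "v \<in> pverts G" for u v
    using that by (induction rule: converse_rtrancl_induct) (auto simp: R_def dest: G.in_arcsD1)
  have cyclic_upstream: "(u, u) \<in> R\<^sup>+" if "(u, c) \<in> R\<^sup>*" "(c, c) \<in> R\<^sup>+" for u c
    using that
  proof (induction rule: converse_rtrancl_induct)
    case (step u w)
    \<comment> \<open>By \<open>pred\<close>, the predecessor \<open>b\<close> of \<open>w\<close>
      on its cycle is the given predecessor \<open>u\<close>.\<close>
    obtain b where b: "(w, b) \<in> R\<^sup>*" "(b, w) \<in> R"
      using step by (meson tranclD2)
    then have "(b, b) \<in> R\<^sup>+" by (meson rtrancl_into_trancl2)
    then show ?case using pred b(2) step.hyps(1) by metis
  qed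
  have cases: "(\<exists>r. (v, r) \<in> R\<^sup>* \<and> r \<in> pverts G \<and> r \<notin> Domain R) \<or> (v, v) \<in> R\<^sup>+"
    if "v \<in> pverts G" for v
  proof (rule reaches_sink_or_cycle[OF fin, of v])
    fix r assume "(v, r) \<in> R\<^sup>*" "r \<notin> Domain R"
    then show ?thesis using closed that by blast
  next
    fix c assume "(v, c) \<in> R\<^sup>*" "(c, c) \<in> R\<^sup>+"
    then show ?thesis using cyclic_upstream by simp
  qed
  have "pairwise (\<lambda>H K. disjnt (pverts H) (pverts K)) (?\<C> \<union> ?\<T>)"
    unfolding pairwise_def disjnt_def
  proof (intro ballI impI)
    fix H K assume HK: "H \<in> ?\<C> \<union> ?\<T>" "K \<in> ?\<C> \<union> ?\<T>" "H \<noteq> K"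
    show "pverts H \<inter> pverts K = {}"
    proof (rule ccontr)
      assume "pverts H \<inter> pverts K \<noteq> {}"
      then obtain v where v: "v \<in> pverts H" "v \<in> pverts K" by blast
      have C: "\<exists>a. L = cycle_component R a \<and> (a, a) \<in> R\<^sup>+ \<and> (a, v) \<in> R\<^sup>*"
        if "L \<in> ?\<C>" "v \<in> pverts L" for L
        using that by (auto simp: cycle_component_def)
      have T: "\<exists>r. L = in_tree R r \<and> (v, r) \<in> R\<^sup>* \<and> r \<notin> Domain R"
        if "L \<in> ?\<T>" "v \<in> pverts L" for L
        using that by (auto simp: in_tree_def)
      from HK(1,2) show False
      proof (elim UnE)
        assume "H \<in> ?\<C>" "K \<in> ?\<C>"
        then obtain a b where "H = cycle_component R a" "(a, a) \<in> R\<^sup>+" "(a, v) \<in> R\<^sup>*"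
            "K = cycle_component R b" "(b, b) \<in> R\<^sup>+" "(b, v) \<in> R\<^sup>*"
          using C[OF _ v(1)] C[OF _ v(2)] by blast
        then show False using CC[of a b v] HK(3) by simp
      next
        assume "H \<in> ?\<C>" "K \<in> ?\<T>"
        then show False using C[OF _ v(1)] T[OF _ v(2)] CT by blast
      next
        assume "H \<in> ?\<T>" "K \<in> ?\<C>"
        then show False using C[OF _ v(2)] T[OF _ v(1)] CT by blast
      next
        assume "H \<in> ?\<T>" "K \<in> ?\<T>"
        then obtain r s where "H = in_tree R r" "(v, r) \<in> R\<^sup>*" "r \<notin> Domain R"
            "K = in_tree R s" "(v, s) \<in> R\<^sup>*" "s \<notin> Domain R"
          using T[OF _ v(1)] T[OF _ v(2)] by blast
        then show False using TT[of v r s] HK(3) by simp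
      qed
    qed
  qed
  moreover have "pverts G = (\<Union>H\<in>?\<C> \<union> ?\<T>. pverts H)"
  proof
    show "pverts G \<subseteq> (\<Union>H\<in>?\<C> \<union> ?\<T>. pverts H)"
    proof
      fix v assume "v \<in> pverts G"
      then consider r where "(v, r) \<in> R\<^sup>*" "r \<in> pverts G" "r \<notin> Domain R" | "(v, v) \<in> R\<^sup>+"
        using cases by blast
      then show "v \<in> (\<Union>H\<in>?\<C> \<union> ?\<T>. pverts H)"
      proof cases
        case 1
        then have "v \<in> pverts (in_tree R r)" by (simp add: in_tree_def)
        then show ?thesis using 1 by blast
      next
        case 2
        moreover have "v \<in> pverts (cycle_component R v)" by (simp add: cycle_component_def)
        ultimately show ?thesis by blast
      qed
    qed
    have "a \<in> pverts G" if "(a, a) \<in> R\<^sup>+" for a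
      using that G.in_arcsD1 unfolding R_def by (meson tranclD)
    then show "(\<Union>H\<in>?\<C> \<union> ?\<T>. pverts H) \<subseteq> pverts G"
      using closed closed' by (auto simp: cycle_component_def in_tree_def)
  qed
  moreover have "R = (\<Union>H\<in>?\<C> \<union> ?\<T>. parcs H)"
  proof
    show "(\<Union>H\<in>?\<C> \<union> ?\<T>. parcs H) \<subseteq> R"
      by (auto simp: cycle_component_def in_tree_def)
    show "R \<subseteq> (\<Union>H\<in>?\<C> \<union> ?\<T>. parcs H)"
    proof (rule subrelI)
      fix u v assume uv: "(u, v) \<in> R"
      then have "v \<in> pverts G" unfolding R_def by (rule G.in_arcsD2)
      \<comment> \<open>An arc is placed according to its head: in the tree of a sink that the head
        leads to or, if the head is cyclic, in the component of the tail, which is then cyclic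
        too.\<close>
      then consider r where "(v, r) \<in> R\<^sup>*" "r \<in> pverts G" "r \<notin> Domain R" | "(v, v) \<in> R\<^sup>+"
        using cases by blast
      then show "(u, v) \<in> (\<Union>H\<in>?\<C> \<union> ?\<T>. parcs H)"
      proof cases
        case 1
        then have "(u, v) \<in> parcs (in_tree R r)" using uv by (simp add: in_tree_def)
        then show ?thesis using 1 by blast
      next
        case 2
        then have "(u, u) \<in> R\<^sup>+" using cyclic_upstream uv by blast
        moreover have "(u, v) \<in> parcs (cycle_component R u)"
          using uv by (simp add: cycle_component_def)
        ultimately show ?thesis by blast
      qed
    qed
  qed
  ultimately show ?thesis
    unfolding disjoint_union_of_def R_def by (intro conjI)
qed

section \<open>Reproducible transitions\<close>

context micro_macro_system
begin

abbreviation repr :: "'a rel" where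
  "repr \<equiv> parcs (transition_graph X A m \<alpha>)"

lemma repr_iff: "(a, b) \<in> repr \<longleftrightarrow> a \<in> A \<and> b \<in> A \<and> \<alpha> ` macrostate X m a \<subseteq> macrostate X m b"
  by (simp add: transition_graph_def reproducible_def)

lemma finite_macrostate: "finite (macrostate X m a)"
  using finite_micro by (simp add: macrostate_def)

lemma macrostate_nonempty: "a \<in> A \<Longrightarrow> macrostate X m a \<noteq> {}"
  using m_surj by (auto simp: macrostate_def)

lemma card_image_macrostate: "card (\<alpha> ` macrostate X m a) = card (macrostate X m a)"
  using \<alpha>_bij by (intro card_image) (auto simp: bij_betw_def macrostate_def intro: inj_on_subset)

lemma card_le_of_repr:
  assumes "(a, b) \<in> repr"
  shows "card (macrostate X m a) \<le> card (macrostate X m b)"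
  using assms card_mono[OF finite_macrostate] card_image_macrostate by (metis repr_iff)

lemma card_le_of_repr_rtrancl:
  assumes "(a, b) \<in> repr\<^sup>*"
  shows "card (macrostate X m a) \<le> card (macrostate X m b)"
  using assms by (induction rule: rtrancl_induct) (auto dest: card_le_of_repr)

lemma entropy_le_of_repr:
  assumes "(a, b) \<in> repr"
  shows "entropy X m a \<le> entropy X m b"
proof -
  \<comment> \<open>Monotonicity of \<open>ln\<close> is applied on the positive reals.\<close>
  have "0 < card (macrostate X m a)"
    using assms finite_macrostate macrostate_nonempty by (simp add: repr_iff card_gt_0_iff)
  then show ?thesis
    using card_le_of_repr[OF assms] by (simp add: entropy_def)
qed

text \<open>Some microstate of \<open>a\<close> exists, and \<open>m\<close> takes only one value at
  its image under \<alpha>.\<close>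

lemma single_valued_repr: "single_valued repr"
proof (rule single_valuedI)
  fix a b c assume ab: "(a, b) \<in> repr" and ac: "(a, c) \<in> repr"
  obtain i where "i \<in> macrostate X m a"
    using ab macrostate_nonempty by (auto simp: repr_iff)
  then have "\<alpha> i \<in> macrostate X m b" "\<alpha> i \<in> macrostate X m c"
    using ab ac by (auto simp: repr_iff)
  then show "b = c" by (simp add: macrostate_def)
qed

text \<open>Supplies the hypothesis \<open>pred\<close> of the decomposition. Walking from
  \<open>a\<close> back to \<open>b\<close> forces equal sizes, so \<alpha> maps \<open>b\<close>
  onto \<open>a\<close>. A microstate of \<open>c\<close> then has the same image as one of
  \<open>b\<close>, and by injectivity the two agree.\<close>

lemma repr_cycle_unique_predecessor:
  assumes "(b, b) \<in> repr\<^sup>+" and ba: "(b, a) \<in> repr" and ca: "(c, a) \<in> repr"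
  shows "b = c"
proof -
  have "(a, b) \<in> repr\<^sup>*"
    using single_valued_cyclic_reachable[OF single_valued_repr assms(1), of a] ba by blast
  then have "card (macrostate X m a) = card (\<alpha> ` macrostate X m b)"
    using card_le_of_repr[OF ba] card_le_of_repr_rtrancl card_image_macrostate
    by (metis le_antisym)
  then have onto: "\<alpha> ` macrostate X m b = macrostate X m a"
    using ba finite_macrostate by (intro card_subset_eq) (auto simp: repr_iff)
  obtain i where i: "i \<in> macrostate X m c"
    using ca macrostate_nonempty by (auto simp: repr_iff)
  then have "\<alpha> i \<in> \<alpha> ` macrostate X m b" using ca onto by (auto simp: repr_iff)
  then obtain j where "j \<in> macrostate X m b" "\<alpha> i = \<alpha> j" by blast
  then show "b = c"
    using i \<alpha>_bij by (auto simp: macrostate_def bij_betw_def dest: inj_onD)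
qed

lemma pair_fin_digraph_transition_graph: "pair_fin_digraph (transition_graph X A m \<alpha>)"
proof -
  have "repr \<subseteq> A \<times> A" by (auto simp: repr_iff)
  then have "finite repr" using finite_macro by (meson finite_SigmaI finite_subset)
  then show ?thesis
    using finite_macro by unfold_locales (auto simp: transition_graph_def)
qed

end

theorem theorem10:
  fixes X :: "'x set" and A :: "'a set" and m :: "'x \<Rightarrow> 'a" and \<alpha> :: "'x \<Rightarrow> 'x"
  assumes "micro_macro_system X A m \<alpha>"
  defines "G \<equiv> transition_graph X A m \<alpha>"
  shows "(\<exists>\<C> \<T>. disjoint_union_of G (\<C> \<union> \<T>) \<and>
             (\<forall>C\<in>\<C>. directed_cycle C \<and>
                (\<forall>a\<in>pverts C. \<forall>b\<in>pverts C. entropy X m a = entropy X m b)) \<and>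
             (\<forall>T\<in>\<T>. \<exists>r. rooted_tree_towards T r \<and> out_arcs (with_proj G) r = {})) \<and>
         (\<forall>(a, b) \<in> parcs G. entropy X m a \<le> entropy X m b)"
proof -
  interpret micro_macro_system X A m \<alpha> by fact
  interpret G: pair_fin_digraph G
    unfolding G_def by (rule pair_fin_digraph_transition_graph)
  have sv: "single_valued (parcs G)" unfolding G_def by (rule single_valued_repr)
  let ?\<C> = "cycle_component (parcs G) ` {a. (a, a) \<in> (parcs G)\<^sup>+}"
  let ?\<T> = "in_tree (parcs G) ` {r \<in> pverts G. r \<notin> Domain (parcs G)}"
  have "disjoint_union_of G (?\<C> \<union> ?\<T>)"
    using disjoint_union_of_cycles_and_in_trees[OF G.pair_fin_digraph sv]
      repr_cycle_unique_predecessor unfolding G_def by blast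
  moreover have "\<forall>C\<in>?\<C>. directed_cycle C \<and>
      (\<forall>a\<in>pverts C. \<forall>b\<in>pverts C. entropy X m a = entropy X m b)"
  proof
    fix C assume "C \<in> ?\<C>"
    then obtain c where C: "C = cycle_component (parcs G) c" and c: "(c, c) \<in> (parcs G)\<^sup>+"
      by blast
    \<comment> \<open>Each vertex of the component is reachable from \<open>c\<close> and leads back
      to it, which bounds the sizes both ways.\<close>
    have "entropy X m a = entropy X m c" if "a \<in> pverts C" for a
    proof -
      have "(c, a) \<in> (parcs G)\<^sup>*" using that C by (simp add: cycle_component_def)
      moreover from this have "(a, c) \<in> (parcs G)\<^sup>*"
        using single_valued_cyclic_reachable[OF sv c] by blast
      ultimately have "card (macrostate X m a) = card (macrostate X m c)"
        unfolding G_def by (simp add: card_le_of_repr_rtrancl le_antisym)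
      then show ?thesis by (simp add: entropy_def)
    qed
    then show "directed_cycle C \<and>
        (\<forall>a\<in>pverts C. \<forall>b\<in>pverts C. entropy X m a = entropy X m b)"
      using directed_cycle_cycle_component[OF sv c] C by metis
  qed
  \<comment> \<open>The roots lie outside \<open>Domain (parcs G)\<close>, so they have no outgoing
    arc in all of \<open>G\<close>, not merely in their trees.\<close>
  moreover have "\<forall>T\<in>?\<T>. \<exists>r. rooted_tree_towards T r \<and> out_arcs (with_proj G) r = {}"
    using rooted_tree_in_tree[OF G.pair_finite_arcs sv]
    by (force simp: out_arcs_def)
  moreover have "\<forall>(a, b) \<in> parcs G. entropy X m a \<le> entropy X m b"
    unfolding G_def using entropy_le_of_repr by blast
  ultimately show ?thesis
    by (intro conjI exI[of _ ?\<C>] exI[of _ ?\<T>])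
qed

end
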